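(* Consider the fluid model described in the context, with regions $\mathcal N=\{1,\dots,N\}$, demand functions $\lambda_{ij}$, travel times $T_{ij}$, service rates $\mu_i$ and fleet size $m$. Let $\mathcal U$ be the set of price vectors $\mathbf u=(u_{ij})_{i,j\in\mathcal N}$ such that $$\sum_{j}\big(\lambda_{ij}(u_{ij})-\lambda_{ji}(u_{ji})\big)=0\qquad\text{for all } i\in\mathcal N,$$ and let $$m_{\mathbf u}:=\sum_{i,j}T_{ij}\lambda_{ij}(u_{ij}).$$ If $\mathbf u\in\mathcal U$ and $m>m_{\mathbf u}$, then an equilibrium exists with $\mathbf c=0$ and $\mathbf v>0$ (i.e. $c_i=0$ and $v_i>0$ for all $i\in\mathcal N$). Otherwise, no equilibrium exists.
   Context: $\mathcal N=\{1,\dots,N\}$ is the set of regions; all sums over $i,j$ run over $\mathcal N$. For each pair $(i,j)$ there is a fixed travel time $T_{ij}\in\mathbb R_{\ge0}$ and a demand function $\lambda_{ij}:\mathbb R_{\ge0}\to\mathbb R_{\ge0}$ of the surge price $u_{ij}$, giving the arrival rate of customers travelling from $i$ to $j$. Each $\lambda_{ij}$ is monotonically decreasing, and there is a surge price $u_{ij}^{\max}$ with $\lambda_{ij}(u_{ij}^{\max})=0$. A price vector is $\mathbf u=(u_{ij})$ with $u_{ij}\in[1,u_{ij}^{\max}]$. Put $\lambda_{ij}^0=\lambda_{ij}(1)$. The service rates $\mu_i$ satisfy $\mu_i>\sum_j\lambda^0_{ij}$ for all $i$. For fixed prices write $\lambda_{ij}=\lambda_{ij}(u_{ij})$ and $\lambda_i=\sum_j\lambda_{ij}$.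 Let $H(x)=1$ if $x>0$ and $H(x)=0$ otherwise. The state consists of $c_i(t)\ge0$ (customers waiting in region $i$) and $v_i(t)\ge0$ (vehicles available in region $i$). With $v_j^i:=v_j(t-T_{ji})$ and $c_j^i:=c_j(t-T_{ji})$, the dynamics are $$\dot c_i=\lambda_i(1-H(v_i))+(\lambda_i-\mu_i)H(c_i)H(v_i),$$ $$\dot v_i=-\lambda_iH(v_i)+(\lambda_i-\mu_i)H(c_i)H(v_i)+\sum_j\Big(\lambda_{ji}H(v_j^i)-(\lambda_{ji}-\mu_j)H(c_j^i)H(v_j^i)\Big).$$ The number of vehicles in transit from $i$ to $j$ at time $t$ is $v_{ij}(t)=\int_{t-T_{ij}}^t\big[\lambda_{ij}H(v_i(\tau))+(\lambda_{ij}-\mu_i)H(c_i(\tau))H(v_i(\tau))\big]d\tau$, and the fleet size $m=\sum_iv_i(t)+\sum_{i,j}v_{ij}(t)$ is the total number of vehicles, waiting and in transit. An equilibrium (for prices $\mathbf u$ and fleet size $m$) is a state $(\mathbf c,\mathbf v)$ with nonnegative entries, constant in time (so delayed values equal current values), with $\dot c_i=0$ and $\dot v_i=0$ for all $i\in\mathcal N$, and with total number of vehicles (waiting and in transit) equal to $m$.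
   Formalization: The formal theorem additionally assumes that the fleet size m is nonzero or some demand λ_ij(u_ij) is nonzero; if m = 0 and all demands vanish, c = 0, v = 0 is an equilibrium although m > m_u fails, so the claim as stated is false there. *)

theory Defs
  imports "HOL-Analysis.Analysis"
begin

text \<open>
  Regions are the elements of a finite type \<open>'n\<close>, so \<open>N = CARD('n)\<close> is an arbitrary
  positive number. In the definitions below,
  \<open>l i j\<close> is the customer rate \<open>\<lambda>\<^sub>i\<^sub>j\<close> at fixed prices, \<open>T i j\<close> is the travel time from
  \<open>i\<close> to \<open>j\<close>, \<open>\<mu> i\<close> is the service rate, and \<open>c i\<close>, \<open>v i\<close> are trajectories, defined at all
  real times so that delayed values make sense.
\<close>

definition H :: "real \<Rightarrow> real" where
  "H x = (if x > 0 then 1 else 0)"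

definition out_rate :: "('n::finite \<Rightarrow> 'n \<Rightarrow> real) \<Rightarrow> 'n \<Rightarrow> real" where
  "out_rate l i = (\<Sum>j\<in>UNIV. l i j)"

definition customer_rhs ::
  "('n::finite \<Rightarrow> 'n \<Rightarrow> real) \<Rightarrow> ('n \<Rightarrow> real) \<Rightarrow> ('n \<Rightarrow> real \<Rightarrow> real) \<Rightarrow> ('n \<Rightarrow> real \<Rightarrow> real)
    \<Rightarrow> 'n \<Rightarrow> real \<Rightarrow> real" where
  "customer_rhs l \<mu> c v i t =
     out_rate l i * (1 - H (v i t)) + (out_rate l i - \<mu> i) * H (c i t) * H (v i t)"

definition vehicle_rhs ::
  "('n::finite \<Rightarrow> 'n \<Rightarrow> real) \<Rightarrow> ('n \<Rightarrow> 'n \<Rightarrow> real) \<Rightarrow> ('n \<Rightarrow> real)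
    \<Rightarrow> ('n \<Rightarrow> real \<Rightarrow> real) \<Rightarrow> ('n \<Rightarrow> real \<Rightarrow> real) \<Rightarrow> 'n \<Rightarrow> real \<Rightarrow> real" where
  "vehicle_rhs l T \<mu> c v i t =
     - out_rate l i * H (v i t) + (out_rate l i - \<mu> i) * H (c i t) * H (v i t)
     + (\<Sum>j\<in>UNIV. l j i * H (v j (t - T j i))
                 - (l j i - \<mu> j) * H (c j (t - T j i)) * H (v j (t - T j i)))"

definition in_transit ::
  "('n::finite \<Rightarrow> 'n \<Rightarrow> real) \<Rightarrow> ('n \<Rightarrow> 'n \<Rightarrow> real) \<Rightarrow> ('n \<Rightarrow> real)
    \<Rightarrow> ('n \<Rightarrow> real \<Rightarrow> real) \<Rightarrow> ('n \<Rightarrow> real \<Rightarrow> real) \<Rightarrow> 'n \<Rightarrow> 'n \<Rightarrow> real \<Rightarrow> real" where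
  "in_transit l T \<mu> c v i j t =
     integral {t - T i j..t}
       (\<lambda>\<tau>. l i j * H (v i \<tau>) + (l i j - \<mu> i) * H (c i \<tau>) * H (v i \<tau>))"

definition total_vehicles ::
  "('n::finite \<Rightarrow> 'n \<Rightarrow> real) \<Rightarrow> ('n \<Rightarrow> 'n \<Rightarrow> real) \<Rightarrow> ('n \<Rightarrow> real)
    \<Rightarrow> ('n \<Rightarrow> real \<Rightarrow> real) \<Rightarrow> ('n \<Rightarrow> real \<Rightarrow> real) \<Rightarrow> real \<Rightarrow> real" where
  "total_vehicles l T \<mu> c v t =
     (\<Sum>i\<in>UNIV. v i t) + (\<Sum>i\<in>UNIV. \<Sum>j\<in>UNIV. in_transit l T \<mu> c v i j t)"

definition rates :: "('n \<Rightarrow> 'n \<Rightarrow> real \<Rightarrow> real) \<Rightarrow> ('n \<Rightarrow> 'n \<Rightarrow> real) \<Rightarrow> 'n \<Rightarrow> 'n \<Rightarrow> real" where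
  "rates lam u i j = lam i j (u i j)"

text \<open>
  An equilibrium is a pair of nonnegative vectors which, read as trajectories that are constant
  for all time (past included), annihilates both right-hand sides and carries \<open>m\<close> vehicles.
\<close>

definition equilibrium ::
  "('n::finite \<Rightarrow> 'n \<Rightarrow> real \<Rightarrow> real) \<Rightarrow> ('n \<Rightarrow> 'n \<Rightarrow> real) \<Rightarrow> ('n \<Rightarrow> real)
    \<Rightarrow> ('n \<Rightarrow> 'n \<Rightarrow> real) \<Rightarrow> real \<Rightarrow> ('n \<Rightarrow> real) \<Rightarrow> ('n \<Rightarrow> real) \<Rightarrow> bool" where
  "equilibrium lam T \<mu> u m c v \<longleftrightarrow>
     (\<forall>i. 0 \<le> c i) \<and> (\<forall>i. 0 \<le> v i) \<and>
     (\<forall>i t. customer_rhs (rates lam u) \<mu> (\<lambda>k _. c k) (\<lambda>k _. v k) i t = 0) \<and>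
     (\<forall>i t. vehicle_rhs (rates lam u) T \<mu> (\<lambda>k _. c k) (\<lambda>k _. v k) i t = 0) \<and>
     (\<forall>t. total_vehicles (rates lam u) T \<mu> (\<lambda>k _. c k) (\<lambda>k _. v k) t = m)"

definition price_vectors :: "('n \<Rightarrow> 'n \<Rightarrow> real) \<Rightarrow> ('n \<Rightarrow> 'n \<Rightarrow> real) set" where
  "price_vectors umax = {u. \<forall>i j. u i j \<in> {1..umax i j}}"

definition balanced_prices ::
  "('n::finite \<Rightarrow> 'n \<Rightarrow> real \<Rightarrow> real) \<Rightarrow> ('n \<Rightarrow> 'n \<Rightarrow> real) \<Rightarrow> ('n \<Rightarrow> 'n \<Rightarrow> real) set" where
  "balanced_prices lam umax =
     {u \<in> price_vectors umax. \<forall>i. (\<Sum>j\<in>UNIV. lam i j (u i j) - lam j i (u j i)) = 0}"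

definition fleet_threshold ::
  "('n::finite \<Rightarrow> 'n \<Rightarrow> real \<Rightarrow> real) \<Rightarrow> ('n \<Rightarrow> 'n \<Rightarrow> real) \<Rightarrow> ('n \<Rightarrow> 'n \<Rightarrow> real) \<Rightarrow> real" where
  "fleet_threshold lam T u = (\<Sum>i\<in>UNIV. \<Sum>j\<in>UNIV. T i j * lam i j (u i j))"

end

theory Submission
  imports Defs
begin

(* Since every out-rate lies below the service rate, the customer equation forces H (c i) H (v i) = 0
   and leaves demand only where vehicles wait. Hence l i j H (v i) = l i j throughout, so the vehicle
   equation becomes the balance condition, and the vehicles in transit number exactly the fleet
   threshold. The remaining m - fleet_threshold vehicles are the waiting ones; if there are none,
   there is no demand and m = 0. *)

text \<open>Without vehicles the right-hand side is \<open>out_rate l i\<close>. With vehicles it is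
  \<open>(out_rate l i - \<mu> i) * H (c i)\<close>, whose first factor is negative, so the queue
  must be empty.\<close>

lemma customer_rhs_const_eq_0_iff:
  assumes "out_rate l i < \<mu> i" and "0 \<le> v i" and "0 \<le> c i"
  shows "customer_rhs l \<mu> (\<lambda>k _. c k) (\<lambda>k _. v k) i t = 0 \<longleftrightarrow>
           (v i = 0 \<longrightarrow> out_rate l i = 0) \<and> (v i > 0 \<longrightarrow> c i = 0)"
  using assms by (auto simp: customer_rhs_def H_def)

lemma out_rate_eq_0_imp:
  assumes "\<And>j. 0 \<le> l i j" and "out_rate l i = 0"
  shows "l i j = 0"
  using assms by (simp add: out_rate_def sum_nonneg_eq_0_iff)

lemma
  assumes "\<And>i j. 0 \<le> l i j" and "\<And>i. 0 \<le> v i"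
    and idle: "\<And>i. v i = 0 \<Longrightarrow> out_rate l i = 0"
    and served: "\<And>i. v i > 0 \<Longrightarrow> c i = 0"
  shows vehicle_rhs_const:
      "vehicle_rhs l T \<mu> (\<lambda>k _. c k) (\<lambda>k _. v k) i t = - (\<Sum>j\<in>UNIV. l i j - l j i)"
    and in_transit_const:
      "0 \<le> T i j \<Longrightarrow> in_transit l T \<mu> (\<lambda>k _. c k) (\<lambda>k _. v k) i j t = T i j * l i j"
proof -
  \<comment> \<open>The coefficient \<open>a\<close> stays arbitrary to cover both
    \<open>out_rate l i - \<mu> i\<close> and the terms \<open>l k j - \<mu> k\<close>.\<close>
  have no_service: "a * H (c k) * H (v k) = 0" for a k
    using served[of k] by (auto simp: H_def)
  have rate: "l k j * H (v k) = l k j" for k j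
  proof (cases "v k = 0")
    case True
    then show ?thesis
      using out_rate_eq_0_imp[of l k j] assms(1) idle by simp
  next
    case False
    then show ?thesis
      using assms(2)[of k] by (simp add: H_def)
  qed
  have "out_rate l i * H (v i) = out_rate l i"
    by (simp add: out_rate_def sum_distrib_right rate)
  then show "vehicle_rhs l T \<mu> (\<lambda>k _. c k) (\<lambda>k _. v k) i t = - (\<Sum>j\<in>UNIV. l i j - l j i)"
    by (simp add: vehicle_rhs_def no_service rate sum_subtractf) (simp add: out_rate_def)
  \<comment> \<open>The integrand is the constant \<open>l i j\<close>. The sign of
    \<open>T i j\<close> matters: a negative value would make the interval empty and the integral
    0.\<close>
  show "in_transit l T \<mu> (\<lambda>k _. c k) (\<lambda>k _. v k) i j t = T i j * l i j" if "0 \<le> T i j"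
    using that by (simp add: in_transit_def no_service rate)
qed

text \<open>Turns the dynamics into algebraic conditions, from which both halves of the theorem are
  read off.\<close>

lemma equilibrium_iff:
  assumes T_nonneg: "\<And>i j. 0 \<le> T i j"
    and rates_nonneg: "\<And>i j. 0 \<le> rates lam u i j"
    and service: "\<And>i. out_rate (rates lam u) i < \<mu> i"
  shows "equilibrium lam T \<mu> u m c v \<longleftrightarrow>
      (\<forall>i. 0 \<le> c i) \<and> (\<forall>i. 0 \<le> v i) \<and>
      (\<forall>i. v i = 0 \<longrightarrow> out_rate (rates lam u) i = 0) \<and> (\<forall>i. v i > 0 \<longrightarrow> c i = 0) \<and>
      (\<forall>i. (\<Sum>j\<in>UNIV. lam i j (u i j) - lam j i (u j i)) = 0) \<and>
      m = (\<Sum>i\<in>UNIV. v i) + fleet_threshold lam T u"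
    (is "_ \<longleftrightarrow> ?c \<and> ?v \<and> ?idle \<and> ?served \<and> ?balance \<and> ?fleet")
proof -
  have customer: "(\<forall>i t. customer_rhs (rates lam u) \<mu> (\<lambda>k _. c k) (\<lambda>k _. v k) i t = 0)
      \<longleftrightarrow> ?idle \<and> ?served" if ?c ?v
    using that by (auto simp: customer_rhs_const_eq_0_iff service)
  \<comment> \<open>These equivalences hold only under \<open>?idle\<close> and
    \<open>?served\<close>, which the customer equation supplies in one direction and the right-hand
    side in the other.\<close>
  have "(\<forall>i t. vehicle_rhs (rates lam u) T \<mu> (\<lambda>k _. c k) (\<lambda>k _. v k) i t = 0) \<longleftrightarrow> ?balance"
    and "(\<forall>t. total_vehicles (rates lam u) T \<mu> (\<lambda>k _. c k) (\<lambda>k _. v k) t = m) \<longleftrightarrow> ?fleet"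
    if ?v ?idle ?served
    using that rates_nonneg T_nonneg
    by (auto simp: vehicle_rhs_const in_transit_const total_vehicles_def fleet_threshold_def
        rates_def)
  with customer show ?thesis
    unfolding equilibrium_def by blast
qed

(* The last assumption excludes only the case of an empty fleet with no demand at all. There
   v = 0 is an equilibrium although m = fleet_threshold lam T u, so the claim would fail. *)
theorem theorem1:
  fixes lam :: "'n::finite \<Rightarrow> 'n \<Rightarrow> real \<Rightarrow> real"
    and T umax u :: "'n \<Rightarrow> 'n \<Rightarrow> real"
    and \<mu> :: "'n \<Rightarrow> real"
    and m :: real
  assumes T_nonneg: "\<And>i j. 0 \<le> T i j"
    and lam_nonneg: "\<And>i j x. 0 \<le> x \<Longrightarrow> 0 \<le> lam i j x"
    and lam_decreasing: "\<And>i j. antimono_on {0..} (lam i j)"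
    and lam_umax: "\<And>i j. lam i j (umax i j) = 0"
    and service: "\<And>i. \<mu> i > (\<Sum>j\<in>UNIV. lam i j 1)"
    and prices: "u \<in> price_vectors umax"
    and nondegenerate: "m \<noteq> 0 \<or> (\<exists>i j. lam i j (u i j) \<noteq> 0)"
  shows "(u \<in> balanced_prices lam umax \<and> m > fleet_threshold lam T u \<longrightarrow>
            (\<exists>c v. equilibrium lam T \<mu> u m c v \<and> (\<forall>i. c i = 0) \<and> (\<forall>i. v i > 0)))
       \<and> (\<not> (u \<in> balanced_prices lam umax \<and> m > fleet_threshold lam T u) \<longrightarrow>
            \<not> (\<exists>c v. equilibrium lam T \<mu> u m c v))"
proof -
  have u_ge_1: "1 \<le> u i j" for i j
    using prices by (simp add: price_vectors_def)
  have rates_nonneg: "0 \<le> rates lam u i j" for i j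
    using lam_nonneg u_ge_1[of i j] by (simp add: rates_def)
  \<comment> \<open>Prices are at least 1, so demand is at most its value at price 1 and the service
    bound carries over to \<open>u\<close>.\<close>
  have "rates lam u i j \<le> lam i j 1" for i j
    using monotone_onD[OF lam_decreasing, of 1 "u i j" i j] u_ge_1[of i j] by (simp add: rates_def)
  then have served_rates: "out_rate (rates lam u) i < \<mu> i" for i
    using service[of i] by (simp add: out_rate_def) (meson le_less_trans sum_mono)
  note eq_iff = equilibrium_iff[OF T_nonneg rates_nonneg served_rates]
  have exists: "\<exists>c v. equilibrium lam T \<mu> u m c v \<and> (\<forall>i. c i = 0) \<and> (\<forall>i. v i > 0)"
    if "u \<in> balanced_prices lam umax" and "m > fleet_threshold lam T u"
  proof (intro exI conjI)
    \<comment> \<open>The vehicles not in transit are spread evenly over the regions, so each region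
      gets a positive share.\<close>
    show "equilibrium lam T \<mu> u m (\<lambda>_. 0) (\<lambda>_. (m - fleet_threshold lam T u) / CARD('n))"
      using that by (simp add: eq_iff balanced_prices_def)
  qed (use that in simp_all)
  have "u \<in> balanced_prices lam umax \<and> m > fleet_threshold lam T u"
    if "equilibrium lam T \<mu> u m c v" for c v
  proof
    have v_nonneg: "\<And>i. 0 \<le> v i"
      and idle: "\<And>i. v i = 0 \<Longrightarrow> out_rate (rates lam u) i = 0"
      and fleet: "m = (\<Sum>i\<in>UNIV. v i) + fleet_threshold lam T u"
      using that by (auto simp: eq_iff)
    show "u \<in> balanced_prices lam umax"
      using that prices by (simp add: eq_iff balanced_prices_def)
    \<comment> \<open>This makes the fleet inequality strict: with no waiting vehicles all demand
      vanishes, hence so do the threshold and \<open>m\<close>, against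
      \<open>nondegenerate\<close>.\<close>
    have "(\<Sum>i\<in>UNIV. v i) \<noteq> 0"
    proof
      assume "(\<Sum>i\<in>UNIV. v i) = 0"
      then have "v i = 0" for i
        using v_nonneg by (simp add: sum_nonneg_eq_0_iff)
      then have "lam i j (u i j) = 0" for i j
        using out_rate_eq_0_imp[of "rates lam u" i j] rates_nonneg idle by (simp add: rates_def)
      with fleet \<open>(\<Sum>i\<in>UNIV. v i) = 0\<close> nondegenerate show False
        by (simp add: fleet_threshold_def)
    qed
    with v_nonneg fleet show "m > fleet_threshold lam T u"
      by (simp add: less_le sum_nonneg)
  qed
  with exists show ?thesis
    by blast
qed

end
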